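(* For each fixed integer $k\ge 0$ the following identities hold: for every integer $n\ge 1$, $$\frac{r_{2n-1}(1,-q^k)}{r_{2n}(1,-1)}=\sum_{j=0}^{\lfloor (k-1)/2\rfloor}(-1)^j q^{j^2}q^{2jn}\begin{bmatrix}k-j-1\\ j\end{bmatrix}_{q^2}\prod_{i=1}^{k-1-2j}(1+q^i),$$ and for every integer $n\ge 0$, $$\frac{r_{2n}(1,-q^k)}{r_{2n}(1,-1)}=\sum_{j=0}^{\lfloor k/2\rfloor}(-1)^j q^{j^2}q^{2jn}\,\frac{[k]}{[2k-2j]}\begin{bmatrix}k-j\\ j\end{bmatrix}_{q^2}\prod_{i=1}^{k-2j}(1+q^i).$$
   Context: Here $q$ is an indeterminate. For integers $n,k\ge0$ the $q$-binomial coefficient is $\begin{bmatrix}n\\k\end{bmatrix}=\frac{(1-q^{n-k+1})\cdots(1-q^n)}{(1-q)\cdots(1-q^k)}$ (equal to $1$ for $k=0$ and $0$ for $k>n$), and $\begin{bmatrix}n\\k\end{bmatrix}_{q^2}$ denotes the same expression with $q$ replaced by $q^2$. The symbol $[m]$ denotes $\frac{1-q^m}{1-q}$. The Rogers-Szegö polynomials are $r_n(x,a)=\sum_{k=0}^{n}\begin{bmatrix}n\\k\end{bmatrix}x^k a^{n-k}$. By a theorem of Gauss, $r_{2n}(1,-1)=\prod_{i=1}^{n}(1-q^{2i-1})$, which is nonzero. Empty sums are $0$ and empty products are $1$.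
   Formalization: For k = 0 the only term of the second sum contains the undefined quotient [0]/[0]; it is read as 1, the only value for which the identity holds there. For k ≥ 1 nothing is changed. *)

theory Defs
  imports "HOL-Computational_Algebra.Computational_Algebra"
begin

definition qint :: "'a::field \<Rightarrow> nat \<Rightarrow> 'a" where
  "qint q m = (1 - q ^ m) / (1 - q)"

(* The case distinction keeps the truncated subtraction n - k from being used when k > n. *)
definition qbinomial :: "'a::field \<Rightarrow> nat \<Rightarrow> nat \<Rightarrow> 'a" where
  "qbinomial q n k =
     (if k \<le> n then (\<Prod>i=1..k. 1 - q ^ (n - k + i)) / (\<Prod>i=1..k. 1 - q ^ i) else 0)"

definition rogers_szego :: "'a::field \<Rightarrow> nat \<Rightarrow> 'a \<Rightarrow> 'a \<Rightarrow> 'a" where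
  "rogers_szego q n x a = (\<Sum>k=0..n. qbinomial q n k * x ^ k * a ^ (n - k))"

(* The quotient [m]/[l] of q-integers with the convention [0]/[0] = 1; the division of the
   field would give 0 in that case. *)
definition qint_quotient :: "'a::field \<Rightarrow> nat \<Rightarrow> nat \<Rightarrow> 'a" where
  "qint_quotient q m l = (if m = 0 \<and> l = 0 then 1 else qint q m / qint q l)"

end

theory Submission
  imports Defs
begin

text \<open>
  Write \<open>r_m(a)\<close> for \<open>r_m(1,a)\<close>. The \<open>q\<close>-Pascal rule gives
  \<open>r_{m+1}(a) = r_m(q a) + a r_m(a)\<close>, and comparing coefficients gives
  \<open>r_{m+1}(a) - r_{m+1}(q a) = (1 - q^(m+1)) a r_m(a)\<close>.
  Hence, with \<open>n \<ge> 1\<close> fixed, \<open>z = q^(2n)\<close>, and \<open>a_k\<close>, \<open>b_k\<close> the quotients of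
  \<open>r_{2n-1}(-q^k)\<close> and \<open>r_{2n}(-q^k)\<close> by \<open>r_{2n}(-1)\<close>, replacing \<open>k\<close> by \<open>k + 1\<close> is
  a linear map:
  \<open>a_{k+1} = b_k + q^k a_k\<close> and \<open>b_{k+1} = b_k + q^k (1 - z) a_k\<close>.
  It starts from \<open>a_0 = 0\<close> and \<open>b_0 = 1\<close>, because the polynomials of odd index vanish at \<open>-1\<close>;
  see \<open>rogers_szego_ratio_recurrence\<close>. Only \<open>z\<close> remembers \<open>n\<close>, so what remains is to solve
  this system for an arbitrary parameter \<open>z\<close>. The case \<open>n = 0\<close>, where there is no polynomial
  behind \<open>a_k\<close>, is the constant solution \<open>b = 1\<close> of the system for \<open>z = 1\<close>.

  Eliminating \<open>b\<close> yields \<open>a_{k+2} = (1 + q^(k+1)) a_{k+1} - q^k z a_k\<close>. The explicit sum for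
  \<open>a_{k+1}\<close> satisfies the same recurrence power by power in \<open>z\<close>: since
  \<open>1 + q^i\<close> splits into two summands, each coefficient identity combines the two Pascal
  rules for base \<open>q\<^sup>2\<close> (\<open>odd_term_rec\<close>). The sum for \<open>b_k = a_{k+1} - q^k a_k\<close> is then a
  termwise consequence, and the factor \<open>[k] / [2k - 2j]\<close> is what remains when the two terms are
  combined (\<open>even_term_eq\<close>).

  The indeterminate enters only through the fact that none of its positive powers is \<open>1\<close>, so
  everything is proved for such an element of an arbitrary field.
\<close>

section \<open>Gaussian binomial coefficients away from roots of unity\<close>

definition not_root_of_unity :: "'a::field \<Rightarrow> bool" where
  "not_root_of_unity q \<longleftrightarrow> (\<forall>m>0. q ^ m \<noteq> 1)"

lemma not_root_of_unityD: "not_root_of_unity q \<Longrightarrow> m > 0 \<Longrightarrow> 1 - q ^ m \<noteq> 0"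
  by (simp add: not_root_of_unity_def)

lemma not_root_of_unity_power2: "not_root_of_unity q \<Longrightarrow> not_root_of_unity (q ^ 2)"
  by (simp add: not_root_of_unity_def flip: power_mult)

lemma qbinomial_denominator_nonzero:
  assumes "not_root_of_unity q"
  shows "(\<Prod>i=1..k. 1 - q ^ i) \<noteq> 0"
  using not_root_of_unityD[OF assms] by auto

lemma qbinomial_0 [simp]: "qbinomial q n 0 = 1"
  by (simp add: qbinomial_def)

lemma qbinomial_eq_0 [simp]: "n < k \<Longrightarrow> qbinomial q n k = 0"
  by (simp add: qbinomial_def)

lemma qbinomial_self: "not_root_of_unity q \<Longrightarrow> qbinomial q n n = 1"
  using qbinomial_denominator_nonzero[of q n] by (simp add: qbinomial_def)

lemma qbinomial_Suc_Suc_absorb: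
  assumes "not_root_of_unity q"
  shows "(1 - q ^ Suc k) * qbinomial q (Suc n) (Suc k) = (1 - q ^ Suc n) * qbinomial q n k"
proof (cases "k \<le> n")
  case True
  then have "n - k + Suc k = Suc n" by simp
  with True show ?thesis
    using not_root_of_unityD[OF assms, of "Suc k"] qbinomial_denominator_nonzero[OF assms, of k]
    by (simp add: qbinomial_def del: power_Suc)
qed (simp add: not_le)

lemma qbinomial_Suc_lower_absorb:
  assumes "not_root_of_unity q" and "k \<le> n"
  shows "(1 - q ^ Suc k) * qbinomial q n (Suc k) = (1 - q ^ (n - k)) * qbinomial q n k"
proof (cases "k = n")
  case False
  with assms(2) obtain d where n: "n = Suc (k + d)"
    by (metis le_neq_implies_less less_imp_Suc_add)
  have "(\<Prod>i=1..Suc k. 1 - q ^ (d + i)) = (1 - q ^ Suc d) * (\<Prod>i=Suc 1..Suc k. 1 - q ^ (d + i))"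
    by (subst prod.atLeast_Suc_atMost) (simp_all del: prod.cl_ivl_Suc)
  also have "(\<Prod>i=Suc 1..Suc k. 1 - q ^ (d + i)) = (\<Prod>i=1..k. 1 - q ^ (Suc d + i))"
    by (subst prod.shift_bounds_cl_Suc_ivl) simp
  finally show ?thesis
    using not_root_of_unityD[OF assms(1), of "Suc k"]
      qbinomial_denominator_nonzero[OF assms(1), of k]
    by (simp add: n qbinomial_def del: power_Suc prod.cl_ivl_Suc)
      (simp add: field_simps)
qed simp

lemma qbinomial_Suc_upper_absorb:
  assumes "not_root_of_unity q" and "k \<le> n"
  shows "(1 - q ^ (Suc n - k)) * qbinomial q (Suc n) k = (1 - q ^ Suc n) * qbinomial q n k"
proof (cases k)
  case (Suc l)
  then have "l \<le> n" using assms(2) by simp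
  have "(1 - q ^ Suc l) * ((1 - q ^ (n - l)) * qbinomial q (Suc n) (Suc l))
      = (1 - q ^ (n - l)) * ((1 - q ^ Suc n) * qbinomial q n l)"
    using qbinomial_Suc_Suc_absorb[OF assms(1), of l n] by (metis mult.left_commute)
  also have "\<dots> = (1 - q ^ Suc l) * ((1 - q ^ Suc n) * qbinomial q n (Suc l))"
    using qbinomial_Suc_lower_absorb[OF assms(1) \<open>l \<le> n\<close>] by (metis mult.left_commute)
  finally show ?thesis
    using not_root_of_unityD[OF assms(1), of "Suc l"] by (simp add: Suc)
qed simp

text \<open>
  Multiplication by \<open>1 - q^(k+1)\<close> turns all three coefficients into multiples of \<open>[n, k]\<close>, and
  the rule becomes \<open>1 - q^(n+1) = (1 - q^(k+1)) + q^(k+1) (1 - q^(n-k))\<close>.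
\<close>

lemma qbinomial_pascal:
  assumes "not_root_of_unity q"
  shows "qbinomial q (Suc n) (Suc k) = qbinomial q n k + q ^ Suc k * qbinomial q n (Suc k)"
proof (cases "k \<le> n")
  case True
  have pow: "q ^ Suc n = q ^ Suc k * q ^ (n - k)"
    using True by (simp flip: power_add)
  have "(1 - q ^ Suc k) * qbinomial q (Suc n) (Suc k)
      = (1 - q ^ Suc k * q ^ (n - k)) * qbinomial q n k"
    using qbinomial_Suc_Suc_absorb[OF assms, of k n] unfolding pow .
  also have "\<dots> = (1 - q ^ Suc k) * qbinomial q n k
      + q ^ Suc k * ((1 - q ^ (n - k)) * qbinomial q n k)"
    by (simp add: algebra_simps)
  also have "\<dots> = (1 - q ^ Suc k) * (qbinomial q n k + q ^ Suc k * qbinomial q n (Suc k))"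
    unfolding qbinomial_Suc_lower_absorb[OF assms True, symmetric] by (simp add: algebra_simps)
  finally show ?thesis
    using not_root_of_unityD[OF assms, of "Suc k"] by simp
qed simp

lemma qbinomial_pascal':
  assumes "not_root_of_unity q" and "k \<le> n"
  shows "qbinomial q (Suc n) (Suc k) = q ^ (n - k) * qbinomial q n k + qbinomial q n (Suc k)"
  using qbinomial_pascal[OF assms(1), of n k] qbinomial_Suc_lower_absorb[OF assms]
  by (simp add: algebra_simps)


section \<open>Functional equations of the Rogers-Szego polynomials\<close>

lemma rogers_szego_1: "rogers_szego q n 1 a = (\<Sum>k\<le>n. qbinomial q n k * a ^ (n - k))"
  by (simp add: rogers_szego_def atLeast0AtMost)

lemma rogers_szego_0 [simp]: "rogers_szego q 0 x a = 1"
  by (simp add: rogers_szego_def)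

text \<open>
  The form \<open>qbinomial_pascal'\<close> is the right one here: its factor \<open>q^(n-k)\<close> turns
  \<open>a^(n-k)\<close> into \<open>(q a)^(n-k)\<close>.
\<close>

lemma rogers_szego_Suc:
  assumes "not_root_of_unity q"
  shows "rogers_szego q (Suc n) 1 a = rogers_szego q n 1 (q * a) + a * rogers_szego q n 1 a"
proof -
  have "rogers_szego q (Suc n) 1 a
      = a ^ Suc n + (\<Sum>k\<le>n. qbinomial q (Suc n) (Suc k) * a ^ (n - k))"
    unfolding rogers_szego_1 by (subst sum.atMost_Suc_shift) simp
  also have "(\<Sum>k\<le>n. qbinomial q (Suc n) (Suc k) * a ^ (n - k))
      = (\<Sum>k\<le>n. qbinomial q n k * (q * a) ^ (n - k)) + (\<Sum>k\<le>n. qbinomial q n (Suc k) * a ^ (n - k))"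
    unfolding sum.distrib[symmetric]
    by (rule sum.cong) (simp_all add: qbinomial_pascal'[OF assms] power_mult_distrib algebra_simps)
  also have "a ^ Suc n + (\<dots>) = rogers_szego q n 1 (q * a)
      + (\<Sum>k\<le>Suc n. qbinomial q n k * a ^ (Suc n - k))"
    unfolding rogers_szego_1 by (subst sum.atMost_Suc_shift) simp
  also have "(\<Sum>k\<le>Suc n. qbinomial q n k * a ^ (Suc n - k)) = a * rogers_szego q n 1 a"
    unfolding rogers_szego_1 by (simp add: sum_distrib_left Suc_diff_le mult.left_commute)
  finally show ?thesis .
qed

text \<open>
  The operator \<open>f(a) \<mapsto> f(a) - f(q a)\<close> multiplies \<open>a^i\<close> by \<open>1 - q^i\<close>, and the absorption
  rule trades this factor for a lower index.
\<close>

lemma rogers_szego_q_difference: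
  assumes "not_root_of_unity q"
  shows "rogers_szego q (Suc n) 1 a - rogers_szego q (Suc n) 1 (q * a)
    = (1 - q ^ Suc n) * a * rogers_szego q n 1 a"
proof -
  have "rogers_szego q (Suc n) 1 a - rogers_szego q (Suc n) 1 (q * a)
      = (\<Sum>k\<le>Suc n. (1 - q ^ (Suc n - k)) * qbinomial q (Suc n) k * a ^ (Suc n - k))"
    unfolding rogers_szego_1 sum_subtractf[symmetric]
    by (rule sum.cong) (simp_all only: power_mult_distrib, simp add: algebra_simps)
  also have "\<dots> = (\<Sum>k\<le>n. (1 - q ^ (Suc n - k)) * qbinomial q (Suc n) k * a ^ (Suc n - k))"
    by (simp add: sum.atMost_Suc)
  also have "\<dots> = (\<Sum>k\<le>n. (1 - q ^ Suc n) * a * (qbinomial q n k * a ^ (n - k)))"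
    by (rule sum.cong, simp, subst qbinomial_Suc_upper_absorb[OF assms])
      (auto simp: Suc_diff_le mult_ac)
  finally show ?thesis
    unfolding rogers_szego_1 by (simp add: sum_distrib_left)
qed

text \<open>
  At \<open>a = -1\<close> the first functional equation expresses \<open>r_{n+2}(-1)\<close> by the difference
  \<open>r_{n+1}(-q) - r_{n+1}(-1)\<close>, which the second one evaluates. Iterating this
  step of two from \<open>r_0 = 1\<close> gives Gauss's product, which does not vanish, and from
  \<open>r_1(-1) = 0\<close> it gives the vanishing for odd index.
\<close>

lemma rogers_szego_minus_1_step:
  assumes "not_root_of_unity q"
  shows "rogers_szego q (Suc (Suc n)) 1 (- 1) = (1 - q ^ Suc n) * rogers_szego q n 1 (- 1)"
proof -
  have "rogers_szego q (Suc (Suc n)) 1 (- 1)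
      = - (rogers_szego q (Suc n) 1 (- 1) - rogers_szego q (Suc n) 1 (q * - 1))"
    unfolding rogers_szego_Suc[OF assms, of "Suc n"] by simp
  also have "\<dots> = (1 - q ^ Suc n) * rogers_szego q n 1 (- 1)"
    unfolding rogers_szego_q_difference[OF assms] by (simp add: algebra_simps)
  finally show ?thesis .
qed

lemma rogers_szego_even_minus_1_nonzero:
  assumes "not_root_of_unity q"
  shows "rogers_szego q (2 * n) 1 (- 1) \<noteq> 0"
proof (induction n)
  case (Suc n)
  then show ?case
    using rogers_szego_minus_1_step[OF assms, of "2 * n"] not_root_of_unityD[OF assms, of "Suc (2 * n)"]
    by simp
qed simp

lemma rogers_szego_odd_minus_1:
  assumes "not_root_of_unity q"
  shows "rogers_szego q (Suc (2 * n)) 1 (- 1) = 0"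
proof (induction n)
  case 0
  show ?case using rogers_szego_Suc[OF assms, of 0 "-1"] by simp
next
  case (Suc n)
  then show ?case using rogers_szego_minus_1_step[OF assms, of "Suc (2 * n)"] by simp
qed


section \<open>The explicit sums\<close>

text \<open>
  The summands of the two right-hand sides, with \<open>z\<close> in place of \<open>q^(2n)\<close>. The index is shifted
  in the odd case: \<open>odd_term q z m\<close> belongs to \<open>k = m + 1\<close>, which avoids the subtraction of \<open>1\<close>.
\<close>

definition odd_term :: "'a::field \<Rightarrow> 'a \<Rightarrow> nat \<Rightarrow> nat \<Rightarrow> 'a" where
  "odd_term q z m j = (- 1) ^ j * q ^ (j ^ 2) * z ^ j * qbinomial (q ^ 2) (m - j) j *
     (\<Prod>i = 1..m - 2 * j. 1 + q ^ i)"

definition even_term :: "'a::field \<Rightarrow> 'a \<Rightarrow> nat \<Rightarrow> nat \<Rightarrow> 'a" where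
  "even_term q z k j = (- 1) ^ j * q ^ (j ^ 2) * z ^ j * qint_quotient q k (2 * k - 2 * j) *
     qbinomial (q ^ 2) (k - j) j * (\<Prod>i = 1..k - 2 * j. 1 + q ^ i)"

lemma odd_term_eq_0: "m < 2 * j \<Longrightarrow> odd_term q z m j = 0"
  by (simp add: odd_term_def)

lemma even_term_eq_0: "k < 2 * j \<Longrightarrow> even_term q z k j = 0"
  by (simp add: even_term_def)

lemma odd_term_0: "odd_term q z m 0 = (\<Prod>i = 1..m. 1 + q ^ i)"
  by (simp add: odd_term_def)

text \<open>
  After cancelling common factors, with \<open>N = m - j\<close>, \<open>x = q^(m-2j)\<close>, \<open>Q = q\<^sup>2\<close> and all
  coefficients in base \<open>Q\<close>, the claim reads
  \<open>(1 + x) [N+1, j+1] = (1 + x Q^(j+1)) [N, j+1] + x (1 + x) [N, j]\<close>.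
  This is one Pascal rule, \<open>[N+1, j+1] = x\<^sup>2 [N, j] + [N, j+1]\<close>, plus \<open>x\<close> times the other.
  For \<open>m \<le> 2 j\<close> some of the truncated exponents no longer mean what they should; there the
  coefficients are \<open>0\<close> or \<open>1\<close>.
\<close>

lemma odd_term_rec:
  assumes "not_root_of_unity q"
  shows "odd_term q z (Suc (Suc m)) (Suc j)
    = (1 + q ^ Suc (Suc m)) * odd_term q z (Suc m) (Suc j) - q ^ Suc m * z * odd_term q z m j"
proof -
  have nru2: "not_root_of_unity (q ^ 2)"
    using assms by (rule not_root_of_unity_power2)
  have sq: "q ^ ((Suc j) ^ 2) = q ^ (j ^ 2) * q ^ Suc (2 * j)"
    unfolding power_add[symmetric]
    by (rule arg_cong[where f = "(^) q"]) (simp add: power2_eq_square)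
  consider "m < 2 * j" | "m = 2 * j" | d where "m = 2 * j + Suc d"
    by (metis add_Suc_right less_imp_Suc_add linorder_neqE_nat)
  then show ?thesis
  proof cases
    case 1
    then show ?thesis by (simp add: odd_term_eq_0)
  next
    case 2
    then show ?thesis
      using qbinomial_self[OF nru2, of j] qbinomial_self[OF nru2, of "Suc j"] sq
      by (simp add: odd_term_def mult_2)
  next
    case 3
    define x where "x = q ^ Suc d"
    define X where "X = qbinomial (q ^ 2) (j + Suc d) j"
    define Y where "Y = qbinomial (q ^ 2) (j + Suc d) (Suc j)"
    define p where "p = (\<Prod>i = 1..d. 1 + q ^ i)"
    define c where "c = (- 1) ^ Suc j * q ^ (j ^ 2) * z ^ Suc j"
    define y where "y = q ^ Suc (2 * j)"
    have idx: "Suc (Suc m) - Suc j = Suc (j + Suc d)" "Suc m - Suc j = j + Suc d"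
      "m - j = j + Suc d" "Suc (Suc m) - 2 * Suc j = Suc d" "Suc m - 2 * Suc j = d"
      "m - 2 * j = Suc d"
      using 3 by simp_all
    have pas1: "qbinomial (q ^ 2) (Suc (j + Suc d)) (Suc j) = X + q * y * Y"
      unfolding X_def Y_def y_def qbinomial_pascal[OF nru2] power_mult[symmetric] by simp
    have x2: "(q ^ 2) ^ Suc d = x ^ 2"
      unfolding x_def power_mult[symmetric] by (rule arg_cong[where f = "(^) q"]) simp
    have pas2: "qbinomial (q ^ 2) (Suc (j + Suc d)) (Suc j) = x ^ 2 * X + Y"
      using qbinomial_pascal'[OF nru2, of j "j + Suc d"] unfolding X_def Y_def
      by (simp add: x2 del: power_Suc)
    have prod: "(\<Prod>i = 1..Suc d. 1 + q ^ i) = p * (1 + x)"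
      by (simp add: p_def x_def)
    have pow: "q ^ Suc m = y * x" "q ^ Suc (Suc m) = q * y * x"
      unfolding y_def x_def 3 by (simp_all add: power_add mult_ac)
    have "odd_term q z (Suc (Suc m)) (Suc j)
        = c * y * p * (qbinomial (q ^ 2) (Suc (j + Suc d)) (Suc j)
            + x * qbinomial (q ^ 2) (Suc (j + Suc d)) (Suc j))"
      unfolding odd_term_def idx sq prod c_def y_def by (simp add: algebra_simps)
    also have "\<dots> = c * y * p * ((x ^ 2 * X + Y) + x * (X + q * y * Y))"
      unfolding pas2[symmetric] by (simp only: pas1[symmetric])
    also have "\<dots> = (1 + q * y * x) * (c * y * Y * p) + y * x * (c * X * (p * (1 + x)))"
      by (simp add: algebra_simps power2_eq_square)
    also have "c * y * Y * p = odd_term q z (Suc m) (Suc j)"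
      unfolding odd_term_def idx sq c_def y_def Y_def p_def by (simp add: algebra_simps)
    also have "c * X * (p * (1 + x)) = - (z * odd_term q z m j)"
      unfolding odd_term_def idx prod c_def X_def by (simp add: algebra_simps)
    finally show ?thesis
      unfolding pow by (simp add: algebra_simps)
  qed
qed

text \<open>
  With \<open>x = q^(k+1-2j)\<close>, \<open>y = q^(2j)\<close>, the quotient of \<open>q\<close>-integers is
  \<open>(1 - y x) / (1 - y x\<^sup>2)\<close>. Its difference from \<open>1\<close> is \<open>y x (1 - x) / (1 - y x\<^sup>2)\<close>; multiplied
  by the last factor \<open>1 + x\<close> of the product, this is \<open>y x = q^(k+1)\<close> times the ratio
  \<open>(1 - x\<^sup>2) / (1 - y x\<^sup>2)\<close> of the two \<open>q\<^sup>2\<close>-binomial coefficients \<open>[k-j, j]\<close> and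
  \<open>[k+1-j, j]\<close>. In the boundary case \<open>k + 1 = 2 j\<close> the quotient is \<open>1\<close> and the second
  odd term vanishes.
\<close>

lemma even_term_eq:
  assumes "not_root_of_unity q"
  shows "even_term q z (Suc k) j = odd_term q z (Suc k) j - q ^ Suc k * odd_term q z k j"
proof -
  have nru2: "not_root_of_unity (q ^ 2)"
    using assms by (rule not_root_of_unity_power2)
  have one: "1 - q \<noteq> 0"
    using not_root_of_unityD[OF assms, of 1] by simp
  consider "Suc k < 2 * j" | "Suc k = 2 * j" | d where "k = 2 * j + d"
    by (metis add_Suc_right less_Suc_eq_le le_Suc_ex linorder_neqE_nat)
  then show ?thesis
  proof cases
    case 1
    then show ?thesis by (simp add: odd_term_eq_0 even_term_eq_0)
  next
    case 2
    then have "2 * Suc k - 2 * j = Suc k" by simp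
    moreover have "qint q (Suc k) \<noteq> 0"
      using one not_root_of_unityD[OF assms, of "Suc k"] by (simp add: qint_def)
    ultimately show ?thesis
      using 2 by (simp add: odd_term_eq_0) (simp add: even_term_def odd_term_def qint_quotient_def)
  next
    case 3
    define x where "x = q ^ Suc d"
    define y where "y = q ^ (2 * j)"
    define X where "X = qbinomial (q ^ 2) (Suc (j + d)) j"
    define Y where "Y = qbinomial (q ^ 2) (j + d) j"
    define p where "p = (\<Prod>i = 1..d. 1 + q ^ i)"
    define c where "c = (- 1) ^ j * q ^ (j ^ 2) * z ^ j"
    have idx: "Suc k - j = Suc (j + d)" "k - j = j + d" "2 * Suc k - 2 * j = 2 * Suc (j + d)"
      "Suc k - 2 * j = Suc d" "k - 2 * j = d"
      using 3 by simp_all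
    have pow: "q ^ Suc k = y * x" "q ^ (2 * Suc (j + d)) = y * x ^ 2"
      unfolding x_def y_def 3 power_mult[symmetric] power_add[symmetric]
      by (rule arg_cong[where f = "(^) q"], simp)+
    have nz: "1 - y * x ^ 2 \<noteq> 0"
      using not_root_of_unityD[OF assms, of "2 * Suc (j + d)"] pow(2) by simp
    have quot: "qint_quotient q (Suc k) (2 * Suc (j + d)) = (1 - y * x) / (1 - y * x ^ 2)"
      using one by (simp only: qint_quotient_def qint_def pow) simp
    have x2: "(q ^ 2) ^ Suc d = x ^ 2"
      unfolding x_def power_mult[symmetric] by (rule arg_cong[where f = "(^) q"]) simp
    have "(1 - (q ^ 2) ^ (Suc (j + d) - j)) * X = (1 - (q ^ 2) ^ Suc (j + d)) * Y"
      unfolding X_def Y_def by (rule qbinomial_Suc_upper_absorb[OF nru2]) simp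
    moreover have "(q ^ 2) ^ (Suc (j + d) - j) = x ^ 2"
    proof -
      have "Suc (j + d) - j = Suc d" by simp
      then show ?thesis by (simp only: x2)
    qed
    moreover have "(q ^ 2) ^ Suc (j + d) = y * x ^ 2"
      unfolding pow(2)[symmetric] by (simp only: power_mult)
    ultimately have XY: "(1 - x ^ 2) * X = (1 - y * x ^ 2) * Y" by simp
    have prod: "(\<Prod>i = 1..Suc d. 1 + q ^ i) = p * (1 + x)"
      by (simp add: p_def x_def)
    have "(1 - y * x) * X * (1 + x) = (1 - y * x ^ 2) * X * (1 + x) - y * x * ((1 - x ^ 2) * X)"
      by (simp add: algebra_simps power2_eq_square)
    also have "\<dots> = (1 - y * x ^ 2) * (X * (1 + x) - y * x * Y)"
      unfolding XY by (simp add: algebra_simps)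
    finally have "(1 - y * x) / (1 - y * x ^ 2) * X * (1 + x) = X * (1 + x) - y * x * Y"
      using nz by (simp add: field_simps)
    then have "c * p * ((1 - y * x) / (1 - y * x ^ 2) * X * (1 + x))
        = c * p * (X * (1 + x) - y * x * Y)"
      by (rule arg_cong)
    then have "c * ((1 - y * x) / (1 - y * x ^ 2)) * X * (p * (1 + x))
        = c * X * (p * (1 + x)) - y * x * (c * Y * p)"
      by (simp only: algebra_simps)
    then show ?thesis
      unfolding even_term_def odd_term_def idx quot prod pow c_def X_def Y_def p_def .
  qed
qed

text \<open>
  Terms beyond the natural range vanish, so sums with different bounds \<open>m div 2\<close> can be
  compared over a common range.
\<close>

lemma sum_odd_term_extend:
  assumes "m div 2 \<le> N"
  shows "(\<Sum>j\<le>N. odd_term q z m j) = (\<Sum>j\<le>m div 2. odd_term q z m j)"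
  using assms by (intro sum.mono_neutral_right) (auto intro!: odd_term_eq_0)

lemma sum_odd_term_rec:
  assumes "not_root_of_unity q"
  shows "(\<Sum>j\<le>Suc (Suc m) div 2. odd_term q z (Suc (Suc m)) j)
    = (1 + q ^ Suc (Suc m)) * (\<Sum>j\<le>Suc m div 2. odd_term q z (Suc m) j)
      - q ^ Suc m * z * (\<Sum>j\<le>m div 2. odd_term q z m j)"
proof -
  have "(\<Sum>j\<le>Suc (Suc m) div 2. odd_term q z (Suc (Suc m)) j)
      = (\<Sum>j\<le>Suc m. odd_term q z (Suc (Suc m)) j)"
    by (rule sum_odd_term_extend[symmetric]) simp
  also have "\<dots> = odd_term q z (Suc (Suc m)) 0 + (\<Sum>j\<le>m. odd_term q z (Suc (Suc m)) (Suc j))"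
    by (rule sum.atMost_Suc_shift)
  also have "\<dots> = (1 + q ^ Suc (Suc m))
        * (odd_term q z (Suc m) 0 + (\<Sum>j\<le>m. odd_term q z (Suc m) (Suc j)))
      - q ^ Suc m * z * (\<Sum>j\<le>m. odd_term q z m j)"
    unfolding odd_term_rec[OF assms] sum_subtractf sum_distrib_left[symmetric]
    by (simp add: odd_term_0 algebra_simps)
  also have "odd_term q z (Suc m) 0 + (\<Sum>j\<le>m. odd_term q z (Suc m) (Suc j))
      = (\<Sum>j\<le>Suc m. odd_term q z (Suc m) j)"
    by (rule sum.atMost_Suc_shift[symmetric])
  also have "\<dots> = (\<Sum>j\<le>Suc m div 2. odd_term q z (Suc m) j)"
    by (rule sum_odd_term_extend) simp
  also have "(\<Sum>j\<le>m. odd_term q z m j) = (\<Sum>j\<le>m div 2. odd_term q z m j)"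
    by (rule sum_odd_term_extend) simp
  finally show ?thesis .
qed

lemma sum_even_term_eq:
  assumes "not_root_of_unity q"
  shows "(\<Sum>j\<le>Suc k div 2. even_term q z (Suc k) j)
    = (\<Sum>j\<le>Suc k div 2. odd_term q z (Suc k) j)
      - q ^ Suc k * (\<Sum>j\<le>k div 2. odd_term q z k j)"
proof -
  have "(\<Sum>j\<le>Suc k div 2. even_term q z (Suc k) j)
    = (\<Sum>j\<le>Suc k div 2. odd_term q z (Suc k) j)
      - q ^ Suc k * (\<Sum>j\<le>Suc k div 2. odd_term q z k j)"
    unfolding even_term_eq[OF assms] by (simp add: sum_subtractf sum_distrib_left)
  also have "(\<Sum>j\<le>Suc k div 2. odd_term q z k j) = (\<Sum>j\<le>k div 2. odd_term q z k j)"
    by (rule sum_odd_term_extend) simp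
  finally show ?thesis .
qed

lemma recurrence_solution:
  fixes a b :: "nat \<Rightarrow> 'a::field"
  assumes nru: "not_root_of_unity q"
    and a_0: "a 0 = 0" and b_0: "b 0 = 1"
    and a_Suc: "\<And>k. a (Suc k) = b k + q ^ k * a k"
    and b_Suc: "\<And>k. b (Suc k) = b k + q ^ k * (1 - z) * a k"
  shows "a (Suc k) = (\<Sum>j\<le>k div 2. odd_term q z k j)"
    and "b k = (\<Sum>j\<le>k div 2. even_term q z k j)"
proof -
  have a_rec: "a (Suc (Suc k)) = (1 + q ^ Suc k) * a (Suc k) - q ^ k * z * a k" for k
    unfolding a_Suc[of "Suc k"] b_Suc using a_Suc[of k] by (simp add: algebra_simps)
  have a: "a (Suc k) = (\<Sum>j\<le>k div 2. odd_term q z k j)" for k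
  proof (induction k rule: induct_nat_012)
    case 0
    show ?case using a_0 b_0 a_Suc[of 0] by (simp add: odd_term_0)
  next
    case 1
    show ?case using a_0 b_0 a_Suc[of 0] a_rec[of 0] by (simp add: odd_term_0)
  next
    case (ge2 k)
    then show ?case unfolding a_rec[of "Suc k"] sum_odd_term_rec[OF nru] by simp
  qed
  show "a (Suc k) = (\<Sum>j\<le>k div 2. odd_term q z k j)" by (rule a)
  show "b k = (\<Sum>j\<le>k div 2. even_term q z k j)"
  proof (cases k)
    \<comment> \<open>Here the convention \<open>[0] / [0] = 1\<close> makes the single summand equal to \<open>1\<close>.\<close>
    case 0
    then show ?thesis by (simp add: b_0 even_term_def qint_quotient_def)
  next
    case (Suc l)
    have "b k = a (Suc k) - q ^ k * a k"
      using a_Suc[of k] by simp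
    then show ?thesis
      unfolding Suc a sum_even_term_eq[OF nru] .
  qed
qed


section \<open>The ratios of Rogers-Szego polynomials\<close>

text \<open>
  Both recurrences are the functional equations evaluated at \<open>a = -q^k\<close>. The requirement
  \<open>n \<ge> 1\<close> is essential: at \<open>n = 0\<close> the truncated index \<open>2 n - 1\<close> would be \<open>0\<close>, and
  \<open>a 0\<close> would be \<open>1\<close>.
\<close>

lemma rogers_szego_ratio_recurrence:
  assumes nru: "not_root_of_unity q" and "n \<ge> 1"
  defines "a \<equiv> \<lambda>k. rogers_szego q (2 * n - 1) 1 (- (q ^ k)) / rogers_szego q (2 * n) 1 (- 1)"
    and "b \<equiv> \<lambda>k. rogers_szego q (2 * n) 1 (- (q ^ k)) / rogers_szego q (2 * n) 1 (- 1)"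
  shows "a 0 = 0" and "b 0 = 1"
    and "a (Suc k) = b k + q ^ k * a k"
    and "b (Suc k) = b k + q ^ k * (1 - q ^ (2 * n)) * a k"
proof -
  obtain l where n: "2 * n = Suc (Suc (2 * l))" "2 * n - 1 = Suc (2 * l)"
    using \<open>n \<ge> 1\<close> by (cases n) auto
  have nz: "rogers_szego q (2 * n) 1 (- 1) \<noteq> 0"
    using nru by (rule rogers_szego_even_minus_1_nonzero)
  show "a 0 = 0"
    unfolding a_def n by (simp add: rogers_szego_odd_minus_1[OF nru])
  show "b 0 = 1"
    using nz by (simp add: b_def)
  have "rogers_szego q (2 * n - 1) 1 (- (q ^ Suc k))
      = rogers_szego q (2 * n) 1 (- (q ^ k)) + q ^ k * rogers_szego q (2 * n - 1) 1 (- (q ^ k))"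
    using rogers_szego_Suc[OF nru, of "2 * n - 1" "- (q ^ k)"] unfolding n by simp
  then show "a (Suc k) = b k + q ^ k * a k"
    by (simp add: a_def b_def add_divide_distrib)
  have "rogers_szego q (2 * n) 1 (- (q ^ Suc k)) = rogers_szego q (2 * n) 1 (- (q ^ k))
      + q ^ k * (1 - q ^ (2 * n)) * rogers_szego q (2 * n - 1) 1 (- (q ^ k))"
    using rogers_szego_q_difference[OF nru, of "2 * n - 1" "- (q ^ k)"] unfolding n
    by (simp add: algebra_simps)
  then show "b (Suc k) = b k + q ^ k * (1 - q ^ (2 * n)) * a k"
    by (simp add: a_def b_def add_divide_distrib)
qed

lemma rogers_szego_odd_ratio:
  assumes "not_root_of_unity q" and "n \<ge> 1"
  shows "rogers_szego q (2 * n - 1) 1 (- (q ^ Suc k)) / rogers_szego q (2 * n) 1 (- 1)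
    = (\<Sum>j\<le>k div 2. odd_term q (q ^ (2 * n)) k j)"
  using recurrence_solution(1)[OF assms(1) rogers_szego_ratio_recurrence[OF assms]] .

text \<open>
  For \<open>n = 0\<close> the quotient is constantly \<open>1\<close> and \<open>z = 1\<close>. There is no polynomial of index
  \<open>-1\<close>, but for \<open>z = 1\<close> the equation for \<open>b\<close> decouples from \<open>a\<close>, so any sequence \<open>a\<close>
  satisfying the first equation completes \<open>b = 1\<close> to a solution of the system.
\<close>

lemma rogers_szego_even_ratio:
  assumes nru: "not_root_of_unity q"
  shows "rogers_szego q (2 * n) 1 (- (q ^ k)) / rogers_szego q (2 * n) 1 (- 1)
    = (\<Sum>j\<le>k div 2. even_term q (q ^ (2 * n)) k j)"
proof (cases "n = 0")
  case True
  define a where "a = rec_nat 0 (\<lambda>k x. 1 + q ^ k * x)"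
  have "(1 :: 'a) = (\<Sum>j\<le>k div 2. even_term q 1 k j)"
    by (rule recurrence_solution(2)[OF nru, where a = a and b = "\<lambda>_. 1"]) (simp_all add: a_def)
  with True show ?thesis by simp
next
  case False
  then have "n \<ge> 1" by simp
  show ?thesis
    using recurrence_solution(2)[OF nru rogers_szego_ratio_recurrence[OF nru \<open>n \<ge> 1\<close>]] .
qed

text \<open>
  A positive power of the indeterminate vanishes at \<open>0\<close>, the constant \<open>1\<close> does not.
\<close>

lemma not_root_of_unity_indeterminate:
  "not_root_of_unity (to_fract [:0, 1:] :: 'a::field_char_0 poly fract)"
  unfolding not_root_of_unity_def
proof (intro allI impI)
  fix m :: nat
  assume "m > 0"
  have pow: "(to_fract [:0, 1:] :: 'a poly fract) ^ m = to_fract ([:0, 1:] ^ m)"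
    by (induction m) (simp_all only: power_0 power_Suc to_fract_1 to_fract_mult)
  have "([:0, 1:] :: 'a poly) ^ m \<noteq> 1"
  proof
    assume "([:0, 1:] :: 'a poly) ^ m = 1"
    then have "poly ([:0, 1:] ^ m) (0 :: 'a) = poly 1 0" by simp
    with \<open>m > 0\<close> show False by (simp add: poly_power zero_power)
  qed
  then show "(to_fract [:0, 1:] :: 'a poly fract) ^ m \<noteq> 1"
    unfolding pow by (metis to_fract_1 to_fract_eq_iff)
qed

theorem theorem2:
  fixes q :: "'a::field_char_0 poly fract" and k :: nat
  assumes q_indeterminate: "q = to_fract [:0, 1:]"
  shows
    "(\<forall>n::nat. n \<ge> 1 \<longrightarrow>
        rogers_szego q (2 * n - 1) 1 (- (q ^ k)) / rogers_szego q (2 * n) 1 (- 1) =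
          (\<Sum>j \<in> {j::nat. int j \<le> (int k - 1) div 2}.
             (- 1) ^ j * q ^ (j ^ 2) * q ^ (2 * j * n) * qbinomial (q ^ 2) (k - j - 1) j *
             (\<Prod>i = 1..k - 1 - 2 * j. 1 + q ^ i)))
     \<and> (\<forall>n::nat.
        rogers_szego q (2 * n) 1 (- (q ^ k)) / rogers_szego q (2 * n) 1 (- 1) =
          (\<Sum>j = 0..k div 2.
             (- 1) ^ j * q ^ (j ^ 2) * q ^ (2 * j * n) * qint_quotient q k (2 * k - 2 * j) *
             qbinomial (q ^ 2) (k - j) j *
             (\<Prod>i = 1..k - 2 * j. 1 + q ^ i)))"
proof (intro conjI allI impI)
  have nru: "not_root_of_unity q"
    unfolding q_indeterminate by (rule not_root_of_unity_indeterminate)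
  fix n :: nat
  have pow: "q ^ (2 * j * n) = (q ^ (2 * n)) ^ j" for j
    by (simp add: mult_ac flip: power_mult)
  show "rogers_szego q (2 * n) 1 (- (q ^ k)) / rogers_szego q (2 * n) 1 (- 1) =
    (\<Sum>j = 0..k div 2. (- 1) ^ j * q ^ (j ^ 2) * q ^ (2 * j * n) *
       qint_quotient q k (2 * k - 2 * j) * qbinomial (q ^ 2) (k - j) j *
       (\<Prod>i = 1..k - 2 * j. 1 + q ^ i))"
    unfolding rogers_szego_even_ratio[OF nru] even_term_def pow atLeast0AtMost ..
  assume "n \<ge> 1"
  show "rogers_szego q (2 * n - 1) 1 (- (q ^ k)) / rogers_szego q (2 * n) 1 (- 1) =
    (\<Sum>j \<in> {j::nat. int j \<le> (int k - 1) div 2}. (- 1) ^ j * q ^ (j ^ 2) * q ^ (2 * j * n) *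
       qbinomial (q ^ 2) (k - j - 1) j * (\<Prod>i = 1..k - 1 - 2 * j. 1 + q ^ i))"
  proof (cases k)
    \<comment> \<open>The integer quotient \<open>-1 div 2\<close> is \<open>-1\<close>, so the sum is empty.\<close>
    case 0
    then have "{j::nat. int j \<le> (int k - 1) div 2} = {}" by auto
    then show ?thesis
      using rogers_szego_ratio_recurrence(1)[OF nru \<open>n \<ge> 1\<close>] 0 by simp
  next
    case (Suc l)
    have index: "{j::nat. int j \<le> (int (Suc l) - 1) div 2} = {..l div 2}"
      by auto
    have "Suc l - j - 1 = l - j" "Suc l - 1 - 2 * j = l - 2 * j" for j
      by simp_all
    then show ?thesis
      unfolding Suc index rogers_szego_odd_ratio[OF nru \<open>n \<ge> 1\<close>] odd_term_def pow by simp
  qed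
qed

end
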